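(* Let $\mathcal{P}$ be the set of integer partitions satisfying all of the following: (i) no part repeats; (ii) adjacent parts do not differ by $1$ if the smaller of the two is even; (iii) for every integer $j$, none of $(2j)+(2j+2)+(2j+4)$, $(2j+1)+(2j+2)+(2j+4)$, $(2j+1)+(2j+3)+(2j+4)$ occurs as a sub-partition. Let $\mathcal{P}'$ be the set of $\pi\in\mathcal{P}$ all of whose parts are at least $3$. Then, as formal power series in $x,q$, writing $N=i+2j+3k$, $$\sum_{\pi\in\mathcal{P}}x^{\ell(\pi)}q^{|\pi|}=\sum_{i,j,k\ge 0}(-1)^k\frac{x^{N}q^{N(N-1)+i+j+3k^2+3k}}{(q;q)_i\,(q^4;q^4)_j\,(q^6;q^6)_k},$$ $$\sum_{\pi\in\mathcal{P}'}x^{\ell(\pi)}q^{|\pi|}=\sum_{i,j,k\ge 0}(-1)^k\frac{x^{N}q^{N(N-1)+3i+5j+3k^2+9k}}{(q;q)_i\,(q^4;q^4)_j\,(q^6;q^6)_k}.$$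
   Context: Partitions are finite weakly increasing sequences of positive integers (the empty partition is included); $\ell(\pi)$ is the number of parts and $|\pi|$ the sum of the parts of $\pi$. A sub-partition of a partition is a contiguous portion of it. For $n\ge 0$, $(a;q)_n=\prod_{0\le t<n}(1-aq^t)$. All identities are identities of formal power series. *)

theory Defs
  imports "HOL-Analysis.Analysis" "HOL-Library.Sublist"
begin

definition partitions :: "nat list set" where
  "partitions = {\<pi>. sorted \<pi> \<and> (\<forall>p \<in> set \<pi>. 0 < p)}"

(* The parts are read as integers in the third condition so that j ranges over all integers;
   sublist is the contiguous sublist relation. *)
definition P_set :: "nat list set" where
  "P_set = {\<pi> \<in> partitions.
     distinct \<pi> \<and>
     (\<forall>i. Suc i < length \<pi> \<longrightarrow> even (\<pi> ! i) \<longrightarrow> \<pi> ! Suc i \<noteq> \<pi> ! i + 1) \<and>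
     (\<forall>j :: int.
        \<not> sublist [2 * j, 2 * j + 2, 2 * j + 4] (map int \<pi>) \<and>
        \<not> sublist [2 * j + 1, 2 * j + 2, 2 * j + 4] (map int \<pi>) \<and>
        \<not> sublist [2 * j + 1, 2 * j + 3, 2 * j + 4] (map int \<pi>))}"

definition P'_set :: "nat list set" where
  "P'_set = {\<pi> \<in> P_set. \<forall>p \<in> set \<pi>. 3 \<le> p}"

definition qpoch :: "'a :: comm_ring_1 \<Rightarrow> 'a \<Rightarrow> nat \<Rightarrow> 'a" where
  "qpoch a q n = (\<Prod>t<n. 1 - a * q ^ t)"

(* Power series in x and q are series in q whose coefficients are series in x. The library
   topology on the outer type is the q-adic one, in which both sides of the identities converge
   (there are finitely many partitions of each n, but infinitely many with a given number of
   parts). The coefficients are rational because division of fps is only defined over types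
   with an inverse; all the denominators below have constant coefficient 1 in q, hence are
   units. *)
type_synonym xq_series = "rat fps fps"

definition x_var :: xq_series where "x_var = fps_const fps_X"

definition q_var :: xq_series where "q_var = fps_X"

end

theory Submission
  imports Defs
begin

unbundle no vec_syntax
unbundle fps_syntax

text \<open>
  Write \<open>A(x)\<close> for the generating function of \<open>\<P>\<close>, as a series in \<open>x\<close> over series in \<open>q\<close>.
  Adding an even number to all parts preserves the conditions, so the members of \<open>\<P>\<close> with parts
  greater than \<open>2m\<close> have generating function \<open>A(xq\<^sup>2\<^sup>m)\<close>; in particular the second identity is
  the first one at \<open>xq\<^sup>2\<close>. Splitting off the smallest parts gives
  \<open>A(x) = (1 + xq) A(xq\<^sup>2) + xq\<^sup>2(1 + xq) A(xq\<^sup>4) + x\<^sup>2q\<^sup>6(1 - xq\<^sup>2) A(xq\<^sup>6)\<close>.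

  If the coefficient of \<open>x\<^sup>N\<close> on the sum side is written as \<open>q\<close> to the power \<open>N(N - 1)\<close> times \<open>c\<^sub>N\<close>, then
  \<open>C(x) = \<Sum> c\<^sub>N x\<^sup>N\<close> is a product of three series, each satisfying a first-order \<open>q\<close>-difference
  equation (it is \<open>(x\<^sup>3q\<^sup>6;q\<^sup>6)\<^sub>\<infinity> / ((xq;q)\<^sub>\<infinity> (x\<^sup>2q;q\<^sup>4)\<^sub>\<infinity>)\<close>, but the infinite products are not needed).
  Since \<open>1 - x\<^sup>3q\<^sup>6\<close> is divisible by \<open>1 - xq\<^sup>2\<close>, this yields
  \<open>(1 - xq)(1 - x\<^sup>2q) C(x) = (1 + xq\<^sup>2 + x\<^sup>2q\<^sup>4) C(xq\<^sup>2)\<close>, which on coefficients is the recurrence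
  given by the equation for \<open>A\<close>.
\<close>

section \<open>The partitions\<close>

text \<open>The parity of the smallest part decides which forbidden triples can start there. Writing
  them relative to \<open>a\<close> eliminates the integer \<open>j\<close>.\<close>

fun allowed3 :: "nat \<Rightarrow> nat \<Rightarrow> nat \<Rightarrow> bool" where
  "allowed3 a b c \<longleftrightarrow>
     (if even a then \<not> (b = a + 2 \<and> c = a + 4)
      else \<not> (b = a + 1 \<and> c = a + 3) \<and> \<not> (b = a + 2 \<and> c = a + 3))"

fun allowed2 :: "nat \<Rightarrow> nat \<Rightarrow> bool" where
  "allowed2 a b \<longleftrightarrow> a < b \<and> (even a \<longrightarrow> b \<noteq> a + 1)"

text \<open>Every condition concerns at most three adjacent parts, so a sliding window of three
  tests them all. Strict increase covers sortedness and distinctness; positivity is left to the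
  bound in \<open>admissible_from\<close>.\<close>

fun admissible :: "nat list \<Rightarrow> bool" where
  "admissible [] \<longleftrightarrow> True"
| "admissible [a] \<longleftrightarrow> True"
| "admissible [a, b] \<longleftrightarrow> allowed2 a b"
| "admissible (a # b # c # l) \<longleftrightarrow> allowed2 a b \<and> allowed3 a b c \<and> admissible (b # c # l)"

lemma all_Suc_less_length_Cons_Cons:
  "(\<forall>i. Suc i < length (a # b # l) \<longrightarrow> Q ((a # b # l) ! i) ((a # b # l) ! Suc i)) \<longleftrightarrow>
   Q a b \<and> (\<forall>i. Suc i < length (b # l) \<longrightarrow> Q ((b # l) ! i) ((b # l) ! Suc i))"
  by (auto simp: less_Suc_eq_0_disj nth_Cons split: nat.splits)

lemma allowed3_iff:
  "allowed3 a b c \<longleftrightarrow> (\<forall>j :: int.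
     \<not> (int a = 2 * j \<and> int b = 2 * j + 2 \<and> int c = 2 * j + 4) \<and>
     \<not> (int a = 2 * j + 1 \<and> int b = 2 * j + 2 \<and> int c = 2 * j + 4) \<and>
     \<not> (int a = 2 * j + 1 \<and> int b = 2 * j + 3 \<and> int c = 2 * j + 4))"
  by simp presburger

text \<open>Induction over windows: a contiguous triple sits either at the front or inside the tail,
  and the conditions on adjacent pairs split the same way.\<close>

lemma admissible_iff:
  "admissible \<pi> \<longleftrightarrow> sorted_wrt (<) \<pi> \<and>
     (\<forall>i. Suc i < length \<pi> \<longrightarrow> even (\<pi> ! i) \<longrightarrow> \<pi> ! Suc i \<noteq> \<pi> ! i + 1) \<and>
     (\<forall>j :: int.
        \<not> sublist [2 * j, 2 * j + 2, 2 * j + 4] (map int \<pi>) \<and>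
        \<not> sublist [2 * j + 1, 2 * j + 2, 2 * j + 4] (map int \<pi>) \<and>
        \<not> sublist [2 * j + 1, 2 * j + 3, 2 * j + 4] (map int \<pi>))"
proof (induction \<pi> rule: admissible.induct)
  case (3 a b)
  then show ?case
    by (auto simp: sublist_Cons_right less_Suc_eq)
next
  case (4 a b c l)
  have s: "sorted_wrt (<) (a # b # c # l) \<longleftrightarrow> a < b \<and> sorted_wrt (<) (b # c # l)"
    by auto
  have t: "sublist [x, y, z] (map int (a # b # c # l)) \<longleftrightarrow>
      int a = x \<and> int b = y \<and> int c = z \<or> sublist [x, y, z] (map int (b # c # l))" for x y z
    by (auto simp: sublist_Cons_right)
  show ?case
    unfolding admissible.simps(4) 4 s t
      all_Suc_less_length_Cons_Cons[where Q = "\<lambda>x y. even x \<longrightarrow> y \<noteq> x + 1"] allowed3_iff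
      allowed2.simps
    by blast
qed (auto simp: sublist_Cons_right)

text \<open>The bound is strict, so \<open>c = 0\<close> expresses positivity, and the sets for even
  \<open>c\<close> are translates of each other.\<close>

definition admissible_from :: "nat \<Rightarrow> nat list set" where
  "admissible_from c = {\<pi>. admissible \<pi> \<and> (\<forall>p \<in> set \<pi>. c < p)}"

lemma P_set_eq: "P_set = admissible_from 0"
  unfolding P_set_def partitions_def admissible_from_def admissible_iff strict_sorted_iff by blast

lemma P'_set_eq: "P'_set = admissible_from 2"
  unfolding P'_set_def P_set_eq admissible_from_def by fastforce

text \<open>The conditions see only differences and parities of parts, and an even translation keeps
  both.\<close>

lemma admissible_shift:
  assumes "even c"
  shows "admissible (map ((+) c) \<pi>) \<longleftrightarrow> admissible \<pi>"
  using assms by (induction \<pi> rule: admissible.induct) auto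

lemma admissible_from_shift:
  assumes "even c"
  shows "admissible_from (d + c) = map ((+) c) ` admissible_from d"
proof (intro equalityI subsetI)
  fix \<pi> assume \<pi>: "\<pi> \<in> admissible_from (d + c)"
  \<comment> \<open>Truncated subtraction inverts the shift here because every part of
    \<open>\<pi>\<close> exceeds \<open>d + c\<close>.\<close>
  define \<rho> where "\<rho> = map (\<lambda>p. p - c) \<pi>"
  have "\<pi> = map ((+) c) \<rho>"
    using \<pi> by (auto simp: \<rho>_def admissible_from_def intro!: map_idI[symmetric])
  moreover have "\<rho> \<in> admissible_from d"
    using \<pi> admissible_shift[OF assms, of \<rho>] \<open>\<pi> = map ((+) c) \<rho>\<close>
    by (auto simp: admissible_from_def)
  ultimately show "\<pi> \<in> map ((+) c) ` admissible_from d" by blast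
qed (auto simp: admissible_from_def admissible_shift[OF assms])

section \<open>Splitting off the smallest parts\<close>

lemma admissible_from_Nil [simp]: "[] \<in> admissible_from c"
  by (simp add: admissible_from_def)

text \<open>Strict increase at the head is absorbed into
  \<open>\<pi> \<in> admissible_from a\<close>, so only the parity condition and the triple starting
  at \<open>a\<close> remain.\<close>

lemma admissible_from_Cons:
  "a # \<pi> \<in> admissible_from c \<longleftrightarrow> c < a \<and> \<pi> \<in> admissible_from a \<and>
     (\<forall>b \<rho>. \<pi> = b # \<rho> \<longrightarrow> even a \<longrightarrow> b \<noteq> a + 1) \<and>
     (\<forall>b d \<rho>. \<pi> = b # d # \<rho> \<longrightarrow> allowed3 a b d)"
proof -
  have gt: "\<forall>p \<in> set \<pi>. a < p" if "admissible (a # \<pi>)"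
    using that by (simp add: admissible_iff)
  then have from_c: "(\<forall>p \<in> set (a # \<pi>). c < p) \<longleftrightarrow> c < a" if "admissible (a # \<pi>)"
    using that by fastforce
  have step: "admissible (a # \<pi>) \<longleftrightarrow> admissible \<pi> \<and>
     (\<forall>b \<rho>. \<pi> = b # \<rho> \<longrightarrow> allowed2 a b) \<and> (\<forall>b d \<rho>. \<pi> = b # d # \<rho> \<longrightarrow> allowed3 a b d)"
    by (cases "a # \<pi>" rule: admissible.cases) (auto simp del: allowed3.simps)
  have "a # \<pi> \<in> admissible_from c \<longleftrightarrow> admissible (a # \<pi>) \<and> c < a \<and> \<pi> \<in> admissible_from a"
    using gt from_c step unfolding admissible_from_def by blast
  also have "\<dots> \<longleftrightarrow> c < a \<and> \<pi> \<in> admissible_from a \<and>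
     (\<forall>b \<rho>. \<pi> = b # \<rho> \<longrightarrow> allowed2 a b) \<and> (\<forall>b d \<rho>. \<pi> = b # d # \<rho> \<longrightarrow> allowed3 a b d)"
    using step by (auto simp: admissible_from_def simp del: allowed3.simps allowed2.simps)
  finally show ?thesis
    by (auto simp: admissible_from_def simp del: allowed3.simps)
qed

lemma admissible_from_mono: "c \<le> d \<Longrightarrow> \<pi> \<in> admissible_from d \<Longrightarrow> \<pi> \<in> admissible_from c"
  by (auto simp: admissible_from_def)

lemma admissible_from_cases:
  assumes "\<pi> \<in> admissible_from c"
  obtains "\<pi> \<in> admissible_from (Suc c)"
    | \<rho> where "\<pi> = Suc c # \<rho>" "\<rho> \<in> admissible_from (Suc c)"
proof (cases \<pi>)
  case (Cons a \<rho>)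
  with assms have *: "c < a" "\<rho> \<in> admissible_from a"
    by (auto simp: admissible_from_Cons)
  show ?thesis
  proof (cases "a = Suc c")
    case False
    with assms * Cons have "\<pi> \<in> admissible_from (Suc c)"
      by (simp add: admissible_from_Cons del: allowed3.simps)
    then show ?thesis by (rule that)
  qed (use Cons * that in auto)
qed (use that in auto)

lemma admissible_from_add2I:
  assumes "\<pi> \<in> admissible_from c" "\<And>\<rho>. \<pi> \<noteq> (c + 1) # \<rho>" "\<And>\<rho>. \<pi> \<noteq> (c + 2) # \<rho>"
  shows "\<pi> \<in> admissible_from (c + 2)"
proof -
  have "\<pi> \<in> admissible_from (Suc c)"
    using assms(1) by (cases rule: admissible_from_cases) (use assms(2) in auto)
  then show ?thesis
    by (cases rule: admissible_from_cases) (use assms(3) in auto)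
qed

text \<open>After 1, 2 the part 3 is excluded because 2 is even, and 4 by the triple 1+2+4. A next
  part of at least 5 violates nothing.\<close>

lemma admissible_from_0_iff_1_2:
  "1 # 2 # \<rho> \<in> admissible_from 0 \<longleftrightarrow> \<rho> \<in> admissible_from 4" (is "?l \<longleftrightarrow> ?r")
proof
  assume l: ?l
  then have "\<rho> \<in> admissible_from 2" "\<And>\<sigma>. \<rho> \<noteq> 3 # \<sigma>" "\<And>\<sigma>. \<rho> \<noteq> 4 # \<sigma>"
    by (auto simp: admissible_from_Cons)
  then show ?r
    using admissible_from_add2I[of \<rho> 2] by simp
next
  assume r: ?r
  then have "b > 4" if "\<rho> = b # \<sigma>" for b \<sigma>
    using that by (auto simp: admissible_from_Cons)
  with r show ?l
    using admissible_from_mono[of 2 4 \<rho>] by (fastforce simp: admissible_from_Cons)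
qed

text \<open>Here 5 is excluded because 4 is even, and 6 by the triple 2+4+6.\<close>

lemma admissible_from_0_iff_2_4:
  "2 # 4 # \<rho> \<in> admissible_from 0 \<longleftrightarrow> \<rho> \<in> admissible_from 6" (is "?l \<longleftrightarrow> ?r")
proof
  assume l: ?l
  then have "\<rho> \<in> admissible_from 4" "\<And>\<sigma>. \<rho> \<noteq> 5 # \<sigma>" "\<And>\<sigma>. \<rho> \<noteq> 6 # \<sigma>"
    by (auto simp: admissible_from_Cons)
  then show ?r
    using admissible_from_add2I[of \<rho> 4] by simp
next
  assume r: ?r
  then have "b > 6" if "\<rho> = b # \<sigma>" for b \<sigma>
    using that by (auto simp: admissible_from_Cons)
  with r show ?l
    using admissible_from_mono[of 4 6 \<rho>] by (fastforce simp: admissible_from_Cons)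
qed

text \<open>Here 5 is excluded because 4 is even, and 6 by the triple 3+4+6.\<close>

lemma admissible_from_2_iff_3_4:
  "3 # 4 # \<rho> \<in> admissible_from 2 \<longleftrightarrow> \<rho> \<in> admissible_from 6" (is "?l \<longleftrightarrow> ?r")
proof
  assume l: ?l
  then have "\<rho> \<in> admissible_from 4" "\<And>\<sigma>. \<rho> \<noteq> 5 # \<sigma>" "\<And>\<sigma>. \<rho> \<noteq> 6 # \<sigma>"
    by (auto simp: admissible_from_Cons)
  then show ?r
    using admissible_from_add2I[of \<rho> 4] by simp
next
  assume r: ?r
  then have "b > 6" if "\<rho> = b # \<sigma>" for b \<sigma>
    using that by (auto simp: admissible_from_Cons)
  with r show ?l
    using admissible_from_mono[of 4 6 \<rho>] by (fastforce simp: admissible_from_Cons)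
qed

text \<open>With second part at least 3, the only forbidden triple that starts with 1 is
  1+3+4.\<close>

lemma admissible_from_0_iff_1:
  assumes "\<pi> \<in> admissible_from 2"
  shows "1 # \<pi> \<in> admissible_from 0 \<longleftrightarrow> (\<forall>\<rho>. \<pi> \<noteq> 3 # 4 # \<rho>)"
proof -
  have "b > 2" if "\<pi> = b # \<sigma>" for b \<sigma>
    using that assms by (simp add: admissible_from_Cons)
  then have "allowed3 1 b d \<longleftrightarrow> \<not> (b = 3 \<and> d = 4)" if "\<pi> = b # d # \<sigma>" for b d \<sigma>
    using that by fastforce
  moreover have "\<pi> \<in> admissible_from 1"
    using assms admissible_from_mono[of 1 2] by simp
  ultimately show ?thesis
    unfolding admissible_from_Cons[of 1] by auto
qed

lemma admissible_from_0_iff_2: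
  assumes "\<pi> \<in> admissible_from 4"
  shows "2 # \<pi> \<in> admissible_from 0"
proof -
  have "b > 4" if "\<pi> = b # \<sigma>" for b \<sigma>
    using that assms by (auto simp: admissible_from_Cons)
  with assms show ?thesis
    using admissible_from_mono[of 2 4 \<pi>] by (fastforce simp: admissible_from_Cons)
qed

text \<open>Case distinction by which of 1, 2, 4 lead the partition. Prefixing 1 to all of
  \<open>admissible_from 2\<close> overshoots by exactly the lists 1, 3, 4, ...; adding these on the
  left avoids a set difference.\<close>

lemma admissible_from_0_decomp:
  "admissible_from 0 \<union> (@) [1, 3, 4] ` admissible_from 6 =
   admissible_from 2 \<union> (@) [1] ` admissible_from 2 \<union> (@) [1, 2] ` admissible_from 4 \<union>
   (@) [2] ` admissible_from 4 \<union> (@) [2, 4] ` admissible_from 6" (is "?L = ?R")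
proof (intro equalityI subsetI)
  fix \<pi> assume "\<pi> \<in> ?L"
  then consider "\<pi> \<in> admissible_from 0" | \<rho> where "\<pi> = 1 # 3 # 4 # \<rho>" "\<rho> \<in> admissible_from 6"
    by auto
  then show "\<pi> \<in> ?R"
  proof cases
    case 1
    then show ?thesis
    proof (cases rule: admissible_from_cases)
      case a: 1
      from a show ?thesis
      proof (cases rule: admissible_from_cases)
        case 1
        then show ?thesis by (simp add: numeral_2_eq_2)
      next
        case (2 \<rho>)
        then have \<pi>: "\<pi> = 2 # \<rho>" and \<rho>: "\<rho> \<in> admissible_from 2" by (simp_all add: numeral_2_eq_2)
        have "\<And>\<sigma>. \<rho> \<noteq> 3 # \<sigma>"
          using a \<pi> by (auto simp: admissible_from_Cons)
        with \<rho> consider "\<rho> \<in> admissible_from 4" | \<sigma> where "\<rho> = 4 # \<sigma>"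
          using admissible_from_add2I[of \<rho> 2] by auto
        then show ?thesis
          using \<pi> \<open>\<pi> \<in> admissible_from 0\<close> by cases (auto simp: admissible_from_0_iff_2_4)
      qed
    next
      case (2 \<rho>)
      from 2(2) consider "\<rho> \<in> admissible_from 2" | \<sigma> where "\<rho> = 2 # \<sigma>"
        by (cases rule: admissible_from_cases) (auto simp: numeral_2_eq_2)
      then show ?thesis
        using 2(1) \<open>\<pi> \<in> admissible_from 0\<close>
        by cases (auto simp: admissible_from_0_iff_1_2[simplified])
    qed
  next
    case (2 \<rho>)
    then show ?thesis
      using admissible_from_2_iff_3_4[of \<rho>] by auto
  qed
next
  fix \<pi> assume "\<pi> \<in> ?R"
  then consider "\<pi> \<in> admissible_from 2" | \<rho> where "\<pi> = 1 # \<rho>" "\<rho> \<in> admissible_from 2"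
    | \<rho> where "\<pi> = 1 # 2 # \<rho>" "\<rho> \<in> admissible_from 4"
    | \<rho> where "\<pi> = 2 # \<rho>" "\<rho> \<in> admissible_from 4"
    | \<rho> where "\<pi> = 2 # 4 # \<rho>" "\<rho> \<in> admissible_from 6"
    by auto
  then show "\<pi> \<in> ?L"
  proof cases
    case 1
    then show ?thesis using admissible_from_mono[of 0 2] by simp
  next
    case (2 \<rho>)
    \<comment> \<open>Either \<open>\<rho>\<close> begins with 3, 4 and \<open>\<pi>\<close> lies in
      the added set, or \<open>\<pi>\<close> is admissible.\<close>
    then show ?thesis
      using admissible_from_0_iff_1[of \<rho>] admissible_from_2_iff_3_4 by auto
  qed (use admissible_from_0_iff_1_2 admissible_from_0_iff_2 admissible_from_0_iff_2_4 in auto)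
qed

section \<open>The functional equation of the partition side\<close>

text \<open>The outer variable counts parts and the inner one is \<open>q\<close>, so the coefficients of this
  series are free of \<open>x\<close>, unlike the elements of \<^typ>\<open>xq_series\<close>, whose outer variable is \<open>q\<close>.\<close>
definition partition_gf :: "nat list set \<Rightarrow> 'a :: comm_ring_1 fps fps" where
  "partition_gf Q = Abs_fps (\<lambda>N. Abs_fps (\<lambda>n.
     of_nat (card {\<pi> \<in> Q. length \<pi> = N \<and> sum_list \<pi> = n})))"

text \<open>The substitution of \<open>c * x\<close> for \<open>x\<close>; with \<open>c\<close> a
  power of \<open>q\<close> it is the shift operator of \<open>q\<close>-difference
  equations.\<close>

definition dilate :: "'a :: comm_ring_1 \<Rightarrow> 'a fps \<Rightarrow> 'a fps" where
  "dilate c f = Abs_fps (\<lambda>n. c ^ n * f $ n)"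

lemma dilate_nth [simp]: "dilate c f $ n = c ^ n * f $ n"
  by (simp add: dilate_def)

lemma dilate_mult: "dilate c (f * g) = dilate c f * dilate c (g :: 'a :: idom fps)"
proof -
  have "dilate c h = h oo (fps_const c * fps_X)" for h
    by (simp add: dilate_def fps_compose_linear)
  then show ?thesis by (simp add: fps_compose_mult_distrib)
qed

section \<open>Generating functions by number and sum of parts\<close>

lemma length_le_sum_list: "0 \<notin> set \<pi> \<Longrightarrow> length \<pi> \<le> sum_list (\<pi> :: nat list)"
  by (induction \<pi>) auto

lemma finite_partitions_sum: "finite {\<pi>. 0 \<notin> set \<pi> \<and> sum_list \<pi> = (n :: nat)}"
proof (rule finite_subset)
  show "{\<pi>. 0 \<notin> set \<pi> \<and> sum_list \<pi> = n} \<subseteq> {\<pi>. set \<pi> \<subseteq> {..n} \<and> length \<pi> \<le> n}"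
    using length_le_sum_list member_le_sum_list by fastforce
qed (simp add: finite_lists_length_le)

text \<open>Excluding the part 0 makes every counted set finite; \<open>card\<close> is 0 on
  infinite sets and would not be additive.\<close>

lemma partition_gf_Un:
  assumes "\<And>\<pi>. \<pi> \<in> P \<union> Q \<Longrightarrow> 0 \<notin> set \<pi>" "P \<inter> Q = {}"
  shows "partition_gf (P \<union> Q) = partition_gf P + partition_gf Q"
proof (intro fps_ext)
  fix N n :: nat
  let ?R = "\<lambda>S. {\<pi> \<in> S. length \<pi> = N \<and> sum_list \<pi> = n}"
  have "finite (?R (P \<union> Q))"
    by (rule finite_subset[OF _ finite_partitions_sum[of n]]) (use assms(1) in auto)
  moreover have "?R (P \<union> Q) = ?R P \<union> ?R Q" "?R P \<inter> ?R Q = {}"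
    using assms(2) by auto
  ultimately have "card (?R (P \<union> Q)) = card (?R P) + card (?R Q)"
    by (simp add: card_Un_disjoint)
  then show "(partition_gf (P \<union> Q) $ N $ n :: 'a) = (partition_gf P + partition_gf Q) $ N $ n"
    by (simp add: partition_gf_def)
qed

lemma partition_gf_append:
  "partition_gf ((@) \<rho> ` Q) =
     fps_X ^ length \<rho> * fps_const (fps_X ^ sum_list \<rho>) * partition_gf Q"
proof (intro fps_ext)
  fix N n :: nat
  let ?R = "\<lambda>S N n. {\<pi> \<in> S. length \<pi> = N \<and> sum_list \<pi> = n}"
  have "?R ((@) \<rho> ` Q) N n = (if length \<rho> \<le> N \<and> sum_list \<rho> \<le> n
          then (@) \<rho> ` ?R Q (N - length \<rho>) (n - sum_list \<rho>) else {})"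
    by (auto split: if_splits)
  moreover have "inj_on ((@) \<rho>) S" for S
    by (simp add: inj_on_def)
  ultimately show "(partition_gf ((@) \<rho> ` Q) $ N $ n :: 'a) =
      (fps_X ^ length \<rho> * fps_const (fps_X ^ sum_list \<rho>) * partition_gf Q) $ N $ n"
    by (auto simp: partition_gf_def mult.assoc fps_X_power_mult_nth card_image)
qed

lemma sum_list_shift: "sum_list (map ((+) c) \<pi>) = sum_list \<pi> + c * length (\<pi> :: nat list)"
  by (induction \<pi>) auto

text \<open>Adding \<open>c\<close> to each of \<open>N\<close> parts raises the sum by
  \<open>c * N\<close>, which is the substitution of \<open>x * q ^ c\<close> for
  \<open>x\<close>.\<close>

lemma partition_gf_shift:
  "partition_gf (map ((+) c) ` Q) = dilate (fps_X ^ c) (partition_gf Q)"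
proof (intro fps_ext)
  fix N n :: nat
  let ?R = "\<lambda>S n. {\<pi> \<in> S. length \<pi> = N \<and> sum_list \<pi> = n}"
  have "?R (map ((+) c) ` Q) n = (if c * N \<le> n then map ((+) c) ` ?R Q (n - c * N) else {})"
    by (auto simp: sum_list_shift split: if_splits)
  moreover have "inj_on (map ((+) c)) S" for S
    by (rule inj_on_subset[of _ UNIV]) (auto simp: inj_map)
  ultimately show "(partition_gf (map ((+) c) ` Q) $ N $ n :: 'a) =
      dilate (fps_X ^ c) (partition_gf Q) $ N $ n"
    by (simp add: partition_gf_def fps_X_power_mult_nth card_image flip: power_mult)
qed

text \<open>Both sides of \<open>admissible_from_0_decomp\<close> are disjoint unions; counting them
  gives the equation, with \<open>z k\<close> standing for \<open>q ^ k\<close>.\<close>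

lemma partition_gf_admissible:
  fixes A :: "'a :: idom fps fps" and z :: "nat \<Rightarrow> 'a fps fps"
  defines "A \<equiv> partition_gf (admissible_from 0)"
  defines "z \<equiv> \<lambda>k. fps_const (fps_X ^ k)"
  shows "A + fps_X ^ 3 * z 8 * dilate (fps_X ^ 6) A =
    dilate (fps_X ^ 2) A + fps_X * z 1 * dilate (fps_X ^ 2) A +
    fps_X ^ 2 * z 3 * dilate (fps_X ^ 4) A + fps_X * z 2 * dilate (fps_X ^ 4) A +
    fps_X ^ 2 * z 6 * dilate (fps_X ^ 6) A"
proof -
  let ?G = "\<lambda>c. admissible_from c"
  have shift: "partition_gf (?G c) = dilate (fps_X ^ c) A" if "even c" for c
    using admissible_from_shift[OF that, of 0] by (simp add: A_def partition_gf_shift)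
  have pos: "0 \<notin> set \<pi>" if "\<pi> \<in> ?G c" for \<pi> c
    using that by (auto simp: admissible_from_def)
  have app: "partition_gf ((@) \<rho> ` ?G c) = fps_X ^ k * z n * dilate (fps_X ^ c) A"
    if "even c" "length \<rho> = k" "sum_list \<rho> = n" for \<rho> c k n
    using that by (simp only: partition_gf_append shift[OF that(1)] z_def)
  have gt: "c < a" if "a # \<pi> \<in> ?G c" for a \<pi> c
    using that by (auto simp: admissible_from_def)
  have forbidden: "1 # 3 # 4 # \<pi> \<notin> ?G 0" for \<pi>
    by (auto simp: admissible_from_def)
  have pos_app: "0 \<notin> set \<pi>" if "\<pi> \<in> (@) \<rho> ` ?G c" "0 \<notin> set \<rho>" for \<pi> \<rho> c
    using that pos by auto
  have "partition_gf (?G 0 \<union> (@) [1, 3, 4] ` ?G 6) =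
      A + partition_gf ((@) [1, 3, 4] ` ?G 6)"
    unfolding A_def by (rule partition_gf_Un) (use forbidden pos pos_app[of _ "[1, 3, 4]"] in auto)
  also have "\<dots> = A + fps_X ^ 3 * z 8 * dilate (fps_X ^ 6) A"
    by (subst app[where k = 3 and n = 8]) simp_all
  finally have lhs: "partition_gf (?G 0 \<union> (@) [1, 3, 4] ` ?G 6) = \<dots>" .
  let ?S1 = "?G 2 \<union> (@) [1] ` ?G 2" and ?S2 = "?G 2 \<union> (@) [1] ` ?G 2 \<union> (@) [1, 2] ` ?G 4"
    and ?S3 = "?G 2 \<union> (@) [1] ` ?G 2 \<union> (@) [1, 2] ` ?G 4 \<union> (@) [2] ` ?G 4"
  \<comment> \<open>The first one or two parts tell the five pieces apart, since all parts of a
    member of \<open>?G c\<close> exceed \<open>c\<close>.\<close>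
  have disj: "?S3 \<inter> (@) [2, 4] ` ?G 6 = {}" "?S2 \<inter> (@) [2] ` ?G 4 = {}"
    "?S1 \<inter> (@) [1, 2] ` ?G 4 = {}" "?G 2 \<inter> (@) [1] ` ?G 2 = {}"
    by (auto dest!: gt)
  have pos_all: "0 \<notin> set \<pi>" if "\<pi> \<in> ?S3 \<union> (@) [2, 4] ` ?G 6" for \<pi>
    using that pos by auto
  have split1: "partition_gf (?S3 \<union> (@) [2, 4] ` ?G 6) =
      (partition_gf ?S3 + partition_gf ((@) [2, 4] ` ?G 6) :: 'a fps fps)"
    by (rule partition_gf_Un[OF _ disj(1)]) (use pos_all in blast)
  have split2: "partition_gf ?S3 = (partition_gf ?S2 + partition_gf ((@) [2] ` ?G 4) :: 'a fps fps)"
    by (rule partition_gf_Un[OF _ disj(2)]) (use pos_all in blast)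
  have split3: "partition_gf ?S2 = (partition_gf ?S1 + partition_gf ((@) [1, 2] ` ?G 4) :: 'a fps fps)"
    by (rule partition_gf_Un[OF _ disj(3)]) (use pos_all in blast)
  have split4: "partition_gf ?S1 = (partition_gf (?G 2) + partition_gf ((@) [1] ` ?G 2) :: 'a fps fps)"
    by (rule partition_gf_Un[OF _ disj(4)]) (use pos_all in blast)
  have "partition_gf ((@) [1] ` ?G 2) = fps_X ^ 1 * z 1 * dilate (fps_X ^ 2) A"
    "partition_gf ((@) [1, 2] ` ?G 4) = fps_X ^ 2 * z 3 * dilate (fps_X ^ 4) A"
    "partition_gf ((@) [2] ` ?G 4) = fps_X ^ 1 * z 2 * dilate (fps_X ^ 4) A"
    "partition_gf ((@) [2, 4] ` ?G 6) = fps_X ^ 2 * z 6 * dilate (fps_X ^ 6) A"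
    by (rule app; simp)+
  then have "partition_gf (?S3 \<union> (@) [2, 4] ` ?G 6) =
    dilate (fps_X ^ 2) A + fps_X * z 1 * dilate (fps_X ^ 2) A +
    fps_X ^ 2 * z 3 * dilate (fps_X ^ 4) A + fps_X * z 2 * dilate (fps_X ^ 4) A +
    fps_X ^ 2 * z 6 * dilate (fps_X ^ 6) A"
    by (simp only: split1 split2 split3 split4 shift even_numeral power_one_right)
  then show ?thesis
    using lhs admissible_from_0_decomp by simp
qed

section \<open>The functional equation of the sum side\<close>

text \<open>The series with terms \<open>f n * x ^ (d * n)\<close>.\<close>

definition spread :: "nat \<Rightarrow> (nat \<Rightarrow> 'a :: comm_ring_1) \<Rightarrow> 'a fps" where
  "spread d f = Abs_fps (\<lambda>m. if d dvd m then f (m div d) else 0)"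

lemma dilate_spread: "d > 0 \<Longrightarrow> dilate c (spread d f) = spread d (\<lambda>n. c ^ (d * n) * f n)"
  by (auto simp: fps_eq_iff spread_def)

text \<open>Passing from \<open>F(x)\<close> to \<open>F(x) - F(c * x)\<close> multiplies the
  coefficient of \<open>x ^ m\<close> by \<open>1 - c ^ m\<close>, so a two-term recurrence becomes
  a first-order equation. A separate \<open>g\<close> allows a dilated series on the right.\<close>

lemma spread_minus_dilate:
  assumes "d > 0" and rec: "\<And>n. (1 - c ^ (d * Suc n)) * f (Suc n) = e * g n"
  shows "spread d f - dilate c (spread d f) = fps_X ^ d * fps_const e * spread d g"
proof (intro fps_ext)
  fix m
  show "(spread d f - dilate c (spread d f)) $ m = (fps_X ^ d * fps_const e * spread d g) $ m"
  proof (cases "d dvd m \<and> m \<noteq> 0")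
    case True
    then obtain n where "m = d * n" "n \<noteq> 0" by auto
    then obtain n where "m = d * Suc n" by (cases n) auto
    then show ?thesis
      using assms(1) rec[of n]
      by (simp add: spread_def mult.assoc fps_X_power_mult_nth algebra_simps)
  next
    case False
    then show ?thesis
      using assms(1) by (auto simp: spread_def mult.assoc fps_X_power_mult_nth dvd_minus_self)
  qed
qed

lemma spread_mult_nth:
  assumes "d > 0"
  shows "(spread d f * F) $ N = (\<Sum>j | d * j \<le> N. f j * F $ (N - d * j))"
proof -
  have fin: "finite {j. d * j \<le> N}"
    by (rule finite_subset[of _ "{..N}"]) (use assms in \<open>auto intro: order_trans[rotated]\<close>)
  have "(spread d f * F) $ N = (\<Sum>i = 0..N. spread d f $ i * F $ (N - i))"
    by (simp add: fps_mult_nth)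
  also have "\<dots> = (\<Sum>i \<in> (*) d ` {j. d * j \<le> N}. spread d f $ i * F $ (N - i))"
    by (rule sum.mono_neutral_right) (auto simp: spread_def elim!: dvdE)
  also have "\<dots> = (\<Sum>j | d * j \<le> N. f j * F $ (N - d * j))"
    using assms by (subst sum.reindex) (auto simp: inj_on_def spread_def)
  finally show ?thesis .
qed

text \<open>The steps 3, 2, 1 realise the weight \<open>i + 2 * j + 3 * k\<close>; \<open>i\<close>
  is determined by \<open>N\<close>, \<open>j\<close> and \<open>k\<close>.\<close>

lemma spread_mult3_nth:
  "(spread 3 w * (spread 2 v * spread 1 u)) $ N =
     (\<Sum>(i, j, k) \<in> {(i, j, k). i + 2 * j + 3 * k = N}. u i * v j * w k)"
proof -
  have "(spread 3 w * (spread 2 v * spread 1 u)) $ N =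
      (\<Sum>k | 3 * k \<le> N. \<Sum>j | 2 * j \<le> N - 3 * k. w k * (v j * u (N - 3 * k - 2 * j)))"
    by (simp add: spread_mult_nth sum_distrib_left) (simp add: spread_def)
  also have "\<dots> = (\<Sum>(k, j) \<in> (SIGMA k : {k. 3 * k \<le> N}. {j. 2 * j \<le> N - 3 * k}).
      w k * (v j * u (N - 3 * k - 2 * j)))"
    by (rule sum.Sigma) (auto intro: finite_subset[of _ "{..N}"])
  also have "\<dots> = (\<Sum>(i, j, k) \<in> {(i, j, k). i + 2 * j + 3 * k = N}. u i * v j * w k)"
    by (rule sum.reindex_bij_witness[where i = "\<lambda>(i, j, k). (k, j)"
          and j = "\<lambda>(k, j). (N - 3 * k - 2 * j, j, k)"]) (auto simp: mult_ac)
  finally show ?thesis .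
qed

text \<open>The coefficient ring \<open>rat fps\<close> is not a field, but constant coefficient 1
  makes \<open>b\<close> a unit.\<close>

lemma divide_mult_cancel:
  fixes a b :: xq_series
  assumes "b $ 0 = 1"
  shows "a / b * b = a"
proof -
  have "b * inverse b = 1"
    using fps_right_inverse[of b 1] assms by (subst fps_inverse_def) simp
  moreover have "a / b = a * inverse b"
    using assms by (intro fps_divide_unit') (simp add: subdegree_eq_0_iff)
  ultimately show ?thesis
    by (simp add: mult.assoc mult.commute[of "inverse b"])
qed

section \<open>Quotients by \<open>q\<close>-Pochhammer symbols and their recurrences\<close>

lemma qpoch_Suc: "qpoch a q (Suc n) = qpoch a q n * (1 - a * q ^ n)"
  by (simp add: qpoch_def)

lemma qpoch_nth_0: "a $ 0 = 0 \<Longrightarrow> qpoch a q n $ 0 = 1"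
  by (induction n) (simp_all add: qpoch_Suc, simp add: qpoch_def)

text \<open>The new denominator factor \<open>1 - a ^ Suc n\<close> cancels. This supplies the
  recurrence for \<open>spread_minus_dilate\<close>.\<close>

lemma div_qpoch_Suc:
  fixes a :: xq_series
  assumes "a $ 0 = 0" "t (Suc n) = s * t n"
  shows "(1 - a ^ Suc n) * (t (Suc n) / qpoch a a (Suc n)) = s * (t n / qpoch a a n)"
proof -
  let ?P = "qpoch a a"
  have P: "?P m $ 0 = 1" for m
    by (rule qpoch_nth_0) fact
  then have "?P n \<noteq> 0"
    by (metis fps_zero_nth zero_neq_one)
  moreover have "?P n * ((1 - a ^ Suc n) * (t (Suc n) / ?P (Suc n))) = t (Suc n) / ?P (Suc n) * ?P (Suc n)"
    by (simp add: qpoch_Suc algebra_simps)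
  moreover have "\<dots> = s * (t n / ?P n * ?P n)"
    by (simp only: divide_mult_cancel[OF P] assms(2))
  moreover have "\<dots> = ?P n * (s * (t n / ?P n))"
    by (simp only: mult_ac)
  ultimately show ?thesis by (metis mult_left_cancel)
qed

text \<open>Without \<open>q ^ (N * (N - 1))\<close> the summand factors over \<open>i\<close>,
  \<open>j\<close>, \<open>k\<close>. These are the terms of Euler's expansions of
  \<open>1/(xq;q)\<close>, \<open>1/(x^2 q;q^4)\<close> and \<open>(x^3 q^6;q^6)\<close>, all with
  infinite index.\<close>

definition "coeff_u i = q_var ^ i / qpoch q_var q_var i"
definition "coeff_v j = q_var ^ j / qpoch (q_var ^ 4) (q_var ^ 4) j"
definition "coeff_w k = (-1) ^ k * q_var ^ (3 * k^2 + 3 * k) / qpoch (q_var ^ 6) (q_var ^ 6) k"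

definition "product_series = spread 3 coeff_w * (spread 2 coeff_v * spread 1 coeff_u)"

text \<open>The equation for \<open>U\<close> has step \<open>q\<close> and is applied twice, giving
  factors \<open>1 - X * Q\<close> and \<open>1 - X * Q ^ 2\<close>. The second is cancelled against
  \<open>1 - X ^ 3 * Q ^ 6\<close> from \<open>W\<close>.\<close>

lemma product_series_functional_eq:
  fixes X Q :: "xq_series fps"
  defines "X \<equiv> fps_X" and "Q \<equiv> fps_const q_var"
  shows "(1 - X * Q) * (1 - X ^ 2 * Q) * product_series =
    (1 + X * Q ^ 2 + X ^ 2 * Q ^ 4) * dilate (q_var ^ 2) product_series"
proof -
  define U V W where "U = spread 1 coeff_u" and "V = spread 2 coeff_v" and "W = spread 3 coeff_w"
  have [simp]: "q_var ^ n $ 0 = 0" if "n > 0" for n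
    using that by (simp add: q_var_def)
  have q0: "q_var $ 0 = 0"
    by (simp add: q_var_def)
  have "(1 - q_var ^ (1 * Suc n)) * coeff_u (Suc n) = q_var * coeff_u n" for n
    using div_qpoch_Suc[OF q0, where t = "\<lambda>n. q_var ^ n"] by (simp add: coeff_u_def)
  then have U: "U - dilate q_var U = X ^ 1 * Q * U"
    unfolding U_def X_def Q_def by (intro spread_minus_dilate) auto
  have "(1 - (q_var ^ 2) ^ (2 * Suc n)) * coeff_v (Suc n) = q_var * coeff_v n" for n
  proof -
    have pow: "(q_var ^ 2) ^ (2 * Suc n) = (q_var ^ 4) ^ Suc n"
      unfolding power_mult[symmetric] by (rule arg_cong[where f = "(^) q_var"]) simp
    show ?thesis
      unfolding pow coeff_v_def by (rule div_qpoch_Suc[where t = "\<lambda>n. q_var ^ n"]) simp_all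
  qed
  then have V: "V - dilate (q_var ^ 2) V = X ^ 2 * Q * V"
    unfolding V_def X_def Q_def by (intro spread_minus_dilate) auto
  \<comment> \<open>The exponent \<open>3 * n^2 + 3 * n\<close> grows by \<open>6 * n + 6\<close>;
    the part \<open>6 * n\<close> is the dilation by \<open>q_var ^ 2\<close>, so the right side
    involves the dilated \<open>W\<close>.\<close>
  have w: "(1 - (q_var ^ 2) ^ (3 * Suc n)) * coeff_w (Suc n) =
      - (q_var ^ 6) * ((q_var ^ 2) ^ (3 * n) * coeff_w n)" for n
  proof -
    have "(-1) ^ Suc n * q_var ^ (3 * (Suc n)^2 + 3 * Suc n) =
        - (q_var ^ (6 * n + 6)) * ((-1) ^ n * q_var ^ (3 * n^2 + 3 * n))"
      by (simp add: power2_eq_square algebra_simps flip: power_add)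
    then have rec: "(1 - (q_var ^ 6) ^ Suc n) * ((-1) ^ Suc n * q_var ^ (3 * (Suc n)^2 + 3 * Suc n) /
          qpoch (q_var ^ 6) (q_var ^ 6) (Suc n)) =
        - (q_var ^ (6 * n + 6)) * ((-1) ^ n * q_var ^ (3 * n^2 + 3 * n) / qpoch (q_var ^ 6) (q_var ^ 6) n)"
      by (intro div_qpoch_Suc[where t = "\<lambda>n. (-1) ^ n * q_var ^ (3 * n^2 + 3 * n)"]) simp_all
    have pow: "(q_var ^ 2) ^ (3 * Suc n) = (q_var ^ 6) ^ Suc n"
      "q_var ^ (6 * n + 6) = q_var ^ 6 * (q_var ^ 2) ^ (3 * n)"
      unfolding power_mult[symmetric] power_add[symmetric]
      by (rule arg_cong[where f = "(^) q_var"]; simp)+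
    show ?thesis
      using rec unfolding coeff_w_def pow by (simp only: mult.assoc minus_mult_left)
  qed
  have W: "W - dilate (q_var ^ 2) W = - (X ^ 3 * Q ^ 6 * dilate (q_var ^ 2) W)"
    unfolding W_def X_def Q_def using spread_minus_dilate[of 3 "q_var ^ 2", OF _ w]
    by (simp add: dilate_spread fps_const_power flip: fps_const_neg)
  \<comment> \<open>Dilating \<open>(1 - X * Q) * U = dilate q_var U\<close> once more yields the
    shift by \<open>q_var ^ 2\<close>.\<close>
  have "dilate q_var (1 - X * Q) = 1 - X * Q ^ 2"
    by (auto simp: fps_eq_iff X_def Q_def power2_eq_square)
  moreover have "(1 - X * Q) * U = dilate q_var U"
    using U by (simp add: algebra_simps)
  moreover have "dilate q_var (dilate q_var U) = dilate (q_var ^ 2) U"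
    by (simp add: fps_eq_iff power2_eq_square power_mult_distrib mult.assoc)
  ultimately have U2: "(1 - X * Q ^ 2) * (1 - X * Q) * U = dilate (q_var ^ 2) U"
    by (metis dilate_mult mult.assoc)
  have "(1 - X * Q ^ 2) * ((1 - X * Q) * (1 - X ^ 2 * Q) * product_series) =
      W * ((V - X ^ 2 * Q * V) * ((1 - X * Q ^ 2) * (1 - X * Q) * U))"
    unfolding product_series_def U_def[symmetric] V_def[symmetric] W_def[symmetric] by algebra
  also have "\<dots> = (1 - X ^ 3 * Q ^ 6) * dilate (q_var ^ 2) W *
      (dilate (q_var ^ 2) V * dilate (q_var ^ 2) U)"
    unfolding U2 using V W by algebra
  also have "\<dots> = (1 - X ^ 3 * Q ^ 6) * dilate (q_var ^ 2) product_series"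
    by (simp add: product_series_def U_def V_def W_def dilate_mult mult.assoc)
  also have "\<dots> = (1 - X * Q ^ 2) *
      ((1 + X * Q ^ 2 + X ^ 2 * Q ^ 4) * dilate (q_var ^ 2) product_series)"
    by algebra
  finally have "(1 - X * Q ^ 2) * ((1 - X * Q) * (1 - X ^ 2 * Q) * product_series) = \<dots>" .
  moreover have "(1 - X * Q ^ 2) $ 0 = 1"
    by (simp add: X_def)
  then have "1 - X * Q ^ 2 \<noteq> 0"
    by (metis fps_zero_nth zero_neq_one)
  ultimately show ?thesis by (metis mult_left_cancel)
qed

section \<open>Comparison\<close>

text \<open>At \<open>x ^ N\<close> both equations express \<open>1 - q ^ (2 * N)\<close> times the
  coefficient through up to three earlier ones. Scaling by \<open>q ^ (N * (N - 1))\<close> turns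
  one recurrence into the other, and the nonzero factor cancels.\<close>

lemma functional_eqs_solution:
  fixes A C :: "'a :: idom fps" and q :: 'a
  defines "X \<equiv> fps_X" and "Q \<equiv> fps_const q"
  assumes A: "A + X ^ 3 * Q ^ 8 * dilate (q ^ 6) A =
      dilate (q ^ 2) A + X * Q * dilate (q ^ 2) A + X ^ 2 * Q ^ 3 * dilate (q ^ 4) A +
      X * Q ^ 2 * dilate (q ^ 4) A + X ^ 2 * Q ^ 6 * dilate (q ^ 6) A"
    and C: "(1 - X * Q) * (1 - X ^ 2 * Q) * C =
      (1 + X * Q ^ 2 + X ^ 2 * Q ^ 4) * dilate (q ^ 2) C"
    and 0: "A $ 0 = C $ 0"
    and q: "\<And>n. n > 0 \<Longrightarrow> q ^ n \<noteq> 1"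
  shows "A $ N = q ^ (N * (N - 1)) * C $ N"
proof (induction N rule: less_induct)
  case (less N)
  have C': "C - X * (Q * C) - X ^ 2 * (Q * C) + X ^ 3 * (Q ^ 2 * C) = dilate (q ^ 2) C +
      X * (Q ^ 2 * dilate (q ^ 2) C) + X ^ 2 * (Q ^ 4 * dilate (q ^ 2) C)"
    using C by algebra
  have A_nth: "(A + X ^ 3 * (Q ^ 8 * dilate (q ^ 6) A)) $ N =
      (dilate (q ^ 2) A + X ^ 1 * (Q * dilate (q ^ 2) A) + X ^ 2 * (Q ^ 3 * dilate (q ^ 4) A) +
      X ^ 1 * (Q ^ 2 * dilate (q ^ 4) A) + X ^ 2 * (Q ^ 6 * dilate (q ^ 6) A)) $ N"
    using A by (simp add: mult.assoc)
  have C_nth: "(C - X ^ 1 * (Q * C) - X ^ 2 * (Q * C) + X ^ 3 * (Q ^ 2 * C)) $ N =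
      (dilate (q ^ 2) C + X ^ 1 * (Q ^ 2 * dilate (q ^ 2) C) + X ^ 2 * (Q ^ 4 * dilate (q ^ 2) C)) $ N"
    using C' by simp
  note A_nth = A_nth[unfolded X_def Q_def fps_add_nth fps_X_power_mult_nth fps_const_power fps_mult_left_const_nth dilate_nth]
  note C_nth = C_nth[unfolded X_def Q_def fps_add_nth fps_sub_nth fps_X_power_mult_nth fps_const_power fps_mult_left_const_nth dilate_nth]
  \<comment> \<open>The recurrences reach back three places; for \<open>N < 3\<close> some terms are
    absent.\<close>
  consider "N = 0" | "N = 1" | "N = 2" | n where "N = n + 3"
    by (metis One_nat_def Suc_1 add.commute add_2_eq_Suc' add_Suc_right not0_implies_Suc numeral_3_eq_3 plus_1_eq_Suc)
  then show ?case
  proof cases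
    case 1
    then show ?thesis using 0 by simp
  next
    case 2
    have "(1 - q ^ 2) * (A $ 1 - C $ 1) = 0"
      using A_nth C_nth 0 unfolding 2 by (simp add: numeral_eq_Suc) algebra
    then show ?thesis using q[of 2] 2 by simp
  next
    case 3
    have A1: "A $ 1 = C $ 1"
      using less[of 1] 3 by simp
    have "A $ 2 = q ^ 4 * A $ 2 + q * (q ^ 2 * A $ 1) + q ^ 3 * C $ 0 +
        q ^ 2 * (q ^ 4 * A $ 1) + q ^ 6 * C $ 0"
      using A_nth 0 unfolding 3 by (simp flip: power_mult)
    then have "A $ 2 - q ^ 4 * A $ 2 =
        q * (q ^ 2 * C $ 1) + q ^ 3 * C $ 0 + q ^ 2 * (q ^ 4 * C $ 1) + q ^ 6 * C $ 0"
      unfolding A1 diff_eq_eq by (rule trans) (simp only: add_ac)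
    moreover have "C $ 2 - q * C $ 1 - q * C $ 0 =
        q ^ 4 * C $ 2 + q ^ 2 * (q ^ 2 * C $ 1) + q ^ 4 * C $ 0"
      using C_nth unfolding 3 by (simp flip: power_mult)
    then have "C $ 2 - q ^ 4 * C $ 2 =
        q ^ 2 * (q ^ 2 * C $ 1) + q ^ 4 * C $ 0 + q * C $ 0 + q * C $ 1"
      unfolding diff_eq_eq by (rule trans) (simp only: add_ac)
    moreover have "(1 - q ^ 4) * (A $ 2 - q ^ 2 * C $ 2) =
        (A $ 2 - q ^ 4 * A $ 2) - q ^ 2 * (C $ 2 - q ^ 4 * C $ 2)"
      by algebra
    ultimately have "(1 - q ^ 4) * (A $ 2 - q ^ 2 * C $ 2) =
        q * (q ^ 2 * C $ 1) + q ^ 3 * C $ 0 + q ^ 2 * (q ^ 4 * C $ 1) + q ^ 6 * C $ 0 -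
        q ^ 2 * (q ^ 2 * (q ^ 2 * C $ 1) + q ^ 4 * C $ 0 + q * C $ 0 + q * C $ 1)"
      by simp
    also have "\<dots> = 0"
      by algebra
    finally have "(1 - q ^ 4) * (A $ 2 - q ^ 2 * C $ 2) = 0" .
    then show ?thesis using q[of 4] 3 by simp
  next
    case (4 n)
    \<comment> \<open>With these all powers become monomials in \<open>e\<close>, \<open>p\<close>,
      \<open>q\<close>, and the induction step is a polynomial identity.\<close>
    define e p where "e = q ^ (n * (n - 1))" and "p = q ^ n"
    have sq3: "(n + 3) * (n + 3 - 1) = n * (n - 1) + 6 * n + 6"
      by (cases n) (simp_all add: algebra_simps)
    have sq2: "(n + 2) * (n + 2 - 1) = n * (n - 1) + 4 * n + 2"
      by (cases n) (simp_all add: algebra_simps)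
    have sq1: "(n + 1) * (n + 1 - 1) = n * (n - 1) + 2 * n"
      by (cases n) (simp_all add: algebra_simps)
    have pow: "q ^ (k * n) = p ^ k" for k
      by (simp add: p_def mult.commute flip: power_mult)
    have IH: "A $ (n + 2) = e * p ^ 4 * q ^ 2 * C $ (n + 2)" "A $ (n + 1) = e * p ^ 2 * C $ (n + 1)"
      "A $ n = e * C $ n"
      using less[of "n + 2"] less[of "n + 1"] less[of n] 4
      unfolding sq2 sq1 by (simp_all only: power_add pow e_def)
    have powk: "(q ^ i) ^ (n + j) = p ^ i * (q ^ i) ^ j" for i j
      by (simp add: power_add p_def mult.commute flip: power_mult)
    have idx: "n + 3 - 3 = n" "n + 3 - 2 = n + 1" "n + 3 - 1 = n + 2"
      "\<not> n + 3 < 3" "\<not> n + 3 < 2" "\<not> n + 3 < 1"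
      by simp_all
    have pk: "(q ^ 2) ^ (n + 3) = p ^ 2 * q ^ 6" "(q ^ 2) ^ (n + 2) = p ^ 2 * q ^ 4"
      "(q ^ 2) ^ (n + 1) = p ^ 2 * q ^ 2" "(q ^ 4) ^ (n + 2) = p ^ 4 * q ^ 8"
      "(q ^ 4) ^ (n + 1) = p ^ 4 * q ^ 4" "(q ^ 6) ^ (n + 1) = p ^ 6 * q ^ 6" "(q ^ 6) ^ n = p ^ 6"
      unfolding powk powk[of 6 0, simplified] by (simp_all flip: power_mult)
    have A_n: "A $ (n + 3) + q ^ 8 * (p ^ 6 * A $ n) =
       p ^ 2 * q ^ 6 * A $ (n + 3) + q * (p ^ 2 * q ^ 4 * A $ (n + 2)) +
       q ^ 3 * (p ^ 4 * q ^ 4 * A $ (n + 1)) + q ^ 2 * (p ^ 4 * q ^ 8 * A $ (n + 2)) +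
       q ^ 6 * (p ^ 6 * q ^ 6 * A $ (n + 1))"
      using A_nth by (simp only: 4 idx if_False pk)
    have C_n: "C $ (n + 3) - q * C $ (n + 2) - q * C $ (n + 1) + q ^ 2 * C $ n =
       p ^ 2 * q ^ 6 * C $ (n + 3) + q ^ 2 * (p ^ 2 * q ^ 4 * C $ (n + 2)) +
       q ^ 4 * (p ^ 2 * q ^ 2 * C $ (n + 1))"
      using C_nth by (simp only: 4 idx if_False pk)
    define a3 c3 c2 c1 c0
      where "a3 = A $ (n + 3)" and "c3 = C $ (n + 3)" and "c2 = C $ (n + 2)"
        and "c1 = C $ (n + 1)" and "c0 = C $ n"
    note vars = a3_def c3_def c2_def c1_def c0_def
    have "a3 - p ^ 2 * q ^ 6 * a3 = q * (p ^ 2 * q ^ 4 * (e * p ^ 4 * q ^ 2 * c2)) +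
       q ^ 3 * (p ^ 4 * q ^ 4 * (e * p ^ 2 * c1)) + q ^ 2 * (p ^ 4 * q ^ 8 * (e * p ^ 4 * q ^ 2 * c2)) +
       q ^ 6 * (p ^ 6 * q ^ 6 * (e * p ^ 2 * c1)) - q ^ 8 * (p ^ 6 * (e * c0))"
    proof -
      have lin: "u - v = s - w" if "u + w = v + s" for u v s w :: 'a
        using that by algebra
      show ?thesis
        by (rule lin) (use A_n in \<open>simp only: IH vars add.assoc\<close>)
    qed
    moreover have "c3 - p ^ 2 * q ^ 6 * c3 = q ^ 2 * (p ^ 2 * q ^ 4 * c2) +
       q ^ 4 * (p ^ 2 * q ^ 2 * c1) + q * c2 + q * c1 - q ^ 2 * c0"
    proof -
      have lin: "u - v = s + t + a + b - w" if "u - a - b + w = v + s + t" for u v s t a b w :: 'a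
        using that by algebra
      show ?thesis
        by (rule lin) (use C_n in \<open>simp only: vars\<close>)
    qed
    moreover have "(1 - p ^ 2 * q ^ 6) * (a3 - e * p ^ 6 * q ^ 6 * c3) =
        (a3 - p ^ 2 * q ^ 6 * a3) - e * p ^ 6 * q ^ 6 * (c3 - p ^ 2 * q ^ 6 * c3)"
      by algebra
    ultimately have "(1 - p ^ 2 * q ^ 6) * (a3 - e * p ^ 6 * q ^ 6 * c3) =
       (q * (p ^ 2 * q ^ 4 * (e * p ^ 4 * q ^ 2 * c2)) +
       q ^ 3 * (p ^ 4 * q ^ 4 * (e * p ^ 2 * c1)) + q ^ 2 * (p ^ 4 * q ^ 8 * (e * p ^ 4 * q ^ 2 * c2)) +
       q ^ 6 * (p ^ 6 * q ^ 6 * (e * p ^ 2 * c1)) - q ^ 8 * (p ^ 6 * (e * c0))) -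
       e * p ^ 6 * q ^ 6 * (q ^ 2 * (p ^ 2 * q ^ 4 * c2) +
       q ^ 4 * (p ^ 2 * q ^ 2 * c1) + q * c2 + q * c1 - q ^ 2 * c0)"
      by (simp only:)
    also have "\<dots> = 0"
      by algebra
    finally have "(1 - p ^ 2 * q ^ 6) * (A $ (n + 3) - e * p ^ 6 * q ^ 6 * C $ (n + 3)) = 0"
      unfolding vars .
    moreover have "p ^ 2 * q ^ 6 = q ^ (2 * n + 6)"
      by (simp add: power_add pow)
    ultimately have "A $ (n + 3) = e * p ^ 6 * q ^ 6 * C $ (n + 3)"
      using q[of "2 * n + 6"] by simp
    then show ?thesis
      unfolding 4 sq3 by (simp only: power_add pow e_def)
  qed
qed

lemma partition_gf_admissible_nth:
  "partition_gf (admissible_from 0) $ N = q_var ^ (N * (N - 1)) * product_series $ N"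
proof (rule functional_eqs_solution)
  show "q_var ^ n \<noteq> 1" if "n > 0" for n
    using that by (metis fps_X_power_nth fps_one_nth gr_implies_not0 q_var_def zero_neq_one)
  show "partition_gf (admissible_from 0) $ 0 = product_series $ 0"
  proof -
    have "{\<pi> \<in> admissible_from 0. length \<pi> = 0 \<and> sum_list \<pi> = n} = (if n = 0 then {[]} else {})" for n
      by auto
    then have "partition_gf (admissible_from 0) $ 0 = (1 :: xq_series)"
      by (simp add: partition_gf_def fps_eq_iff)
    moreover have "qpoch a b 0 = 1" for a b :: xq_series
      by (simp add: qpoch_def)
    then have "product_series $ 0 = 1"
      using divide_mult_cancel[of 1 1]
      by (simp add: product_series_def spread_def coeff_u_def coeff_v_def coeff_w_def)
    ultimately show ?thesis by simp
  qed
qed (use partition_gf_admissible[where ?'a = "rat fps"] product_series_functional_eq in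
    \<open>simp_all add: q_var_def fps_const_power\<close>)

section \<open>Convergence and comparison of the two sums\<close>

text \<open>The shift \<open>s\<close> is \<open>0\<close> for \<open>\<P>\<close> and \<open>2\<close> for \<open>\<P>'\<close>.\<close>
definition hyper_term :: "nat \<Rightarrow> nat \<times> nat \<times> nat \<Rightarrow> xq_series" where
  "hyper_term s = (\<lambda>(i, j, k). let N = i + 2 * j + 3 * k in
     (-1) ^ k * (x_var ^ N * q_var ^ (N * (N - 1) + i + j + 3 * k^2 + 3 * k + s * N)) /
     (qpoch q_var q_var i * qpoch (q_var ^ 4) (q_var ^ 4) j * qpoch (q_var ^ 6) (q_var ^ 6) k))"

text \<open>Multiplying by the common denominator, a unit, turns the single quotient into the
  product of three.\<close>

lemma hyper_term_eq:
  fixes i j k :: nat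
  defines "N \<equiv> i + 2 * j + 3 * k"
  shows "hyper_term s (i, j, k) =
    x_var ^ N * (q_var ^ (s * N) * (q_var ^ (N * (N - 1)) * (coeff_u i * coeff_v j * coeff_w k)))"
    (is "_ = ?r")
proof -
  let ?P1 = "qpoch q_var q_var i" and ?P2 = "qpoch (q_var ^ 4) (q_var ^ 4) j"
    and ?P3 = "qpoch (q_var ^ 6) (q_var ^ 6) k"
  let ?n = "(-1) ^ k * (x_var ^ N * q_var ^ (N * (N - 1) + i + j + 3 * k^2 + 3 * k + s * N))"
  have P: "?P1 $ 0 = 1" "?P2 $ 0 = 1" "?P3 $ 0 = 1"
    by (simp_all add: qpoch_nth_0 q_var_def)
  then have P0: "(?P1 * ?P2 * ?P3) $ 0 = 1"
    by simp
  have "?r * (?P1 * ?P2 * ?P3) = x_var ^ N * (q_var ^ (s * N) * (q_var ^ (N * (N - 1)) *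
      ((coeff_u i * ?P1) * (coeff_v j * ?P2) * (coeff_w k * ?P3))))"
    by (simp only: mult_ac)
  also have "\<dots> = ?n"
    unfolding coeff_u_def coeff_v_def coeff_w_def divide_mult_cancel[OF P(1)]
      divide_mult_cancel[OF P(2)] divide_mult_cancel[OF P(3)] power_add
    by (simp only: mult_ac)
  also have "\<dots> = ?n / (?P1 * ?P2 * ?P3) * (?P1 * ?P2 * ?P3)"
    by (rule divide_mult_cancel[OF P0, symmetric])
  also have "?n / (?P1 * ?P2 * ?P3) = hyper_term s (i, j, k)"
    by (simp add: hyper_term_def N_def Let_def)
  finally show ?thesis
    using P0 by (metis fps_zero_nth mult_right_cancel zero_neq_one)
qed

text \<open>The power of \<open>q\<close> in the numerator is at least \<open>i + j + k\<close> and
  the denominator is a unit, so each power of \<open>q\<close> receives only finitely many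
  terms.\<close>

lemma hyper_term_nth_eq_0:
  assumes "n < i + j + k"
  shows "hyper_term s (i, j, k) $ n = 0"
proof -
  define N where "N = i + 2 * j + 3 * k"
  define E where "E = N * (N - 1) + i + j + 3 * k^2 + 3 * k + s * N"
  let ?P = "qpoch q_var q_var i * qpoch (q_var ^ 4) (q_var ^ 4) j * qpoch (q_var ^ 6) (q_var ^ 6) k"
  have P: "?P $ 0 = 1"
    by (simp add: qpoch_nth_0 q_var_def)
  have "hyper_term s (i, j, k) = (-1) ^ k * (x_var ^ N * q_var ^ E) / ?P"
    by (simp add: hyper_term_def N_def E_def Let_def)
  also have "\<dots> = (-1) ^ k * (x_var ^ N * q_var ^ E) * inverse ?P"
    using P by (intro fps_divide_unit') (simp add: subdegree_eq_0_iff)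
  also have "\<dots> = fps_X ^ E * ((-1) ^ k * x_var ^ N * inverse ?P)"
    by (simp add: q_var_def mult_ac)
  finally show ?thesis
    using assms by (simp add: fps_X_power_mult_nth E_def)
qed

lemma partition_gf_admissible_from_nth:
  assumes "even s"
  shows "partition_gf (admissible_from s) $ N = q_var ^ (s * N) *
    (q_var ^ (N * (N - 1)) * (\<Sum>(i, j, k) \<in> {(i, j, k). i + 2 * j + 3 * k = N}.
       coeff_u i * coeff_v j * coeff_w k))"
proof -
  have "partition_gf (admissible_from s) $ N = (q_var ^ s) ^ N * partition_gf (admissible_from 0) $ N"
    using admissible_from_shift[OF assms, of 0] by (simp add: partition_gf_shift q_var_def)
  then show ?thesis
    by (simp only: partition_gf_admissible_nth product_series_def spread_mult3_nth power_mult)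
qed

text \<open>By \<open>has_sum_fpsI\<close> it suffices to compare finite sums at each power of
  \<open>q\<close>; both are grouped by \<open>N\<close>, the exponent of \<open>x\<close>.\<close>

lemma has_sum_admissible_from:
  assumes "even s"
  shows "\<exists>S. ((\<lambda>\<pi>. x_var ^ length \<pi> * q_var ^ sum_list \<pi>) has_sum S) (admissible_from s) \<and>
             (hyper_term s has_sum S) UNIV"
proof -
  let ?T = "\<lambda>N. {(i, j, k). i + 2 * j + 3 * k = (N :: nat)}"
  let ?G = "\<lambda>n. {\<pi> \<in> admissible_from s. sum_list \<pi> = n}"
  define S :: xq_series where "S = Abs_fps (\<lambda>n. \<Sum>\<pi> \<in> ?G n. fps_X ^ length \<pi>)"
  have pos: "0 \<notin> set \<pi>" if "\<pi> \<in> admissible_from s" for \<pi>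
    using that by (auto simp: admissible_from_def)
  have fin: "finite (?G n)" for n
    by (rule finite_subset[OF _ finite_partitions_sum[of n]]) (use pos in auto)
  have nth: "(x_var ^ N * f) $ n = fps_X ^ N * f $ n" for N n and f :: xq_series
    by (simp add: x_var_def fps_const_power)
  have "((\<lambda>\<pi>. x_var ^ length \<pi> * q_var ^ sum_list \<pi>) has_sum S) (admissible_from s)"
  proof (rule has_sum_fpsI)
    fix n
    have "{\<pi> \<in> admissible_from s. (x_var ^ length \<pi> * q_var ^ sum_list \<pi>) $ n \<noteq> 0} = ?G n"
      by (auto simp: nth q_var_def)
    then show "finite {\<pi> \<in> admissible_from s. (x_var ^ length \<pi> * q_var ^ sum_list \<pi>) $ n \<noteq> 0}"
      "S $ n = (\<Sum>\<pi> | \<pi> \<in> admissible_from s \<and> (x_var ^ length \<pi> * q_var ^ sum_list \<pi>) $ n \<noteq> 0.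
         (x_var ^ length \<pi> * q_var ^ sum_list \<pi>) $ n)"
      by (simp_all add: fin S_def nth q_var_def)
  qed
  moreover have "(hyper_term s has_sum S) UNIV"
  proof (rule has_sum_fpsI)
    fix n
    let ?R = "{t \<in> UNIV. hyper_term s t $ n \<noteq> 0}"
    have R: "i + j + k \<le> n" if "(i, j, k) \<in> ?R" for i j k
      using that hyper_term_nth_eq_0[of n i j k s] by (auto simp: not_less[symmetric])
    have "?R \<subseteq> {..n} \<times> {..n} \<times> {..n}"
      using R by fastforce
    then show "finite ?R"
      by (rule finite_subset) auto
    have finT: "finite (?T N)" for N
      by (rule finite_subset[of _ "{..N} \<times> {..N} \<times> {..N}"]) auto
    have "S $ n = (\<Sum>\<pi> \<in> ?G n. fps_X ^ length \<pi>)"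
      by (simp add: S_def)
    \<comment> \<open>The bound \<open>3 * n\<close> serves both sides: partitions of
      \<open>n\<close> have at most \<open>n\<close> parts, and \<open>i + j + k \<le> n\<close>
      gives \<open>i + 2 * j + 3 * k \<le> 3 * n\<close>.\<close>
    also have "\<dots> = (\<Sum>N \<le> 3 * n. \<Sum>\<pi> \<in> {\<pi> \<in> ?G n. length \<pi> = N}. fps_X ^ length \<pi>)"
      using fin length_le_sum_list[OF pos] by (intro sum.group[symmetric]) fastforce+
    also have "\<dots> = (\<Sum>N \<le> 3 * n. (x_var ^ N * partition_gf (admissible_from s) $ N) $ n)"
      by (intro sum.cong) (simp_all add: nth partition_gf_def conj_ac)
    also have "\<dots> = (\<Sum>N \<le> 3 * n. \<Sum>t \<in> ?T N. hyper_term s t $ n)"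
    proof (intro sum.cong refl)
      fix N
      have "x_var ^ N * partition_gf (admissible_from s) $ N = (\<Sum>t \<in> ?T N. hyper_term s t)"
        unfolding partition_gf_admissible_from_nth[OF assms] sum_distrib_left
        by (intro sum.cong) (auto simp: hyper_term_eq)
      then show "(x_var ^ N * partition_gf (admissible_from s) $ N) $ n = (\<Sum>t \<in> ?T N. hyper_term s t $ n)"
        by (simp add: fps_sum_nth)
    qed
    also have "\<dots> = (\<Sum>t \<in> (\<Union>N \<le> 3 * n. ?T N). hyper_term s t $ n)"
      by (rule sum.UNION_disjoint[symmetric]) (use finT in auto)
    also have "\<dots> = (\<Sum>t \<in> ?R. hyper_term s t $ n)"
      by (rule sum.mono_neutral_right) (use finT R in fastforce)+
    finally show "S $ n = (\<Sum>t \<in> ?R. hyper_term s t $ n)" .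
  qed
  ultimately show ?thesis by blast
qed

theorem mainTheorem5:
  fixes x q :: xq_series
  defines "x \<equiv> x_var" and "q \<equiv> q_var"
  shows "(\<exists>S.
      ((\<lambda>\<pi>. x ^ length \<pi> * q ^ sum_list \<pi>) has_sum S) P_set \<and>
      ((\<lambda>(i, j, k). let N = i + 2 * j + 3 * k in
          (-1) ^ k * (x ^ N * q ^ (N * (N - 1) + i + j + 3 * k^2 + 3 * k)) /
          (qpoch q q i * qpoch (q ^ 4) (q ^ 4) j * qpoch (q ^ 6) (q ^ 6) k))
        has_sum S) UNIV) \<and>
    (\<exists>S'.
      ((\<lambda>\<pi>. x ^ length \<pi> * q ^ sum_list \<pi>) has_sum S') P'_set \<and>
      ((\<lambda>(i, j, k). let N = i + 2 * j + 3 * k in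
          (-1) ^ k * (x ^ N * q ^ (N * (N - 1) + 3 * i + 5 * j + 3 * k^2 + 9 * k)) /
          (qpoch q q i * qpoch (q ^ 4) (q ^ 4) j * qpoch (q ^ 6) (q ^ 6) k))
        has_sum S') UNIV)"
proof -
  \<comment> \<open>The second exponent exceeds the first by \<open>2 * N\<close>, the effect of
    replacing \<open>x\<close> by \<open>x * q ^ 2\<close>.\<close>
  have "N * (N - 1) + 3 * i + 5 * j + 3 * k^2 + 9 * k =
      N * (N - 1) + i + j + 3 * k^2 + 3 * k + 2 * N" if "N = i + 2 * j + 3 * k" for N i j k :: nat
    using that by simp
  then have "hyper_term 2 = (\<lambda>(i, j, k). let N = i + 2 * j + 3 * k in
          (-1) ^ k * (x ^ N * q ^ (N * (N - 1) + 3 * i + 5 * j + 3 * k^2 + 9 * k)) /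
          (qpoch q q i * qpoch (q ^ 4) (q ^ 4) j * qpoch (q ^ 6) (q ^ 6) k))"
    unfolding hyper_term_def Let_def x_def q_def by presburger
  moreover have "hyper_term 0 = (\<lambda>(i, j, k). let N = i + 2 * j + 3 * k in
          (-1) ^ k * (x ^ N * q ^ (N * (N - 1) + i + j + 3 * k^2 + 3 * k)) /
          (qpoch q q i * qpoch (q ^ 4) (q ^ 4) j * qpoch (q ^ 6) (q ^ 6) k))"
    by (simp add: hyper_term_def x_def q_def)
  ultimately show ?thesis
    using has_sum_admissible_from[of 0] has_sum_admissible_from[of 2]
    unfolding P_set_eq P'_set_eq x_def q_def by simp
qed

end
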